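(* Let $N\ge3$, $\varepsilon=e^{2\pi i/(2N)}$, $s_n=\sin(\pi n/N)$, $c_n=\cos(\pi n/N)$. The Kähler potential $K_{\rm AD}$ of the $(\mathfrak a_1,\mathfrak a_{N-1})$ theory admits the following decomposition in terms of the character coefficients $R_n$: $$ K_{\rm AD}=\begin{cases}\displaystyle\frac{N}{4\pi}\sum_{n=1}^{N-1}\frac{s_n}{c_n}\,|R_n|^2 & N\ \text{odd},\\[4mm] \displaystyle\frac N{4\pi}\sum_{\substack{n=1\\ n\ne\nu}}^{N-1}\frac{s_n}{c_n}\,|R_n|^2+\frac N{8\pi}\left(R_\nu\sum_{\substack{n=1\\ n\neq\nu}}^{N-1}\frac{\varepsilon^{2n}-1}{c_n}\,\overline{R_n}+\text{c.c.}\right) & N=2\nu\ \text{even},\end{cases} $$ where c.c. denotes the complex conjugate of the preceding term in the parentheses.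
   Context: The (intrinsic) Seiberg-Witten curve and differential of the $(\mathfrak a_1,\mathfrak a_{N-1})$ Argyres-Douglas theory are $\hat y^2=x^N-\sum_{n=1}^{N-2}u_nx^n+v$ and $\lambda=\sqrt{-2}\,\hat y\,dx$. Let $v\ne0$, fix a branch of $\log v$, and put $v_n=v^{\frac nN-1}u_n$ ($1\le n\le N-2$), $x=v^{1/N}z$. For small $v_n$ and each $\zeta$ with $\zeta^N=-1$, let $z_\zeta$ be the root near $\zeta$ of $z^N-\sum_{n=1}^{N-2}v_nz^n+1$, and define $R(\zeta)$ by $i\pi R(\zeta)=\int_{z=0}^{z=z_\zeta}\lambda$ along a small deformation of the segment $[0,\zeta]$ in the $z$-plane, with $\hat y$ continued from $\hat y=v^{1/2}$ at $z=0$ and $\sqrt{-2}=-i\sqrt2$. The character coefficients $R_0,\dots,R_{N-1}$ (independent of $\zeta$) are defined by $$R(\zeta)=\sum_{n=0}^{N-1}\zeta^nR_n\qquad\text{for all }\zeta\text{ with }\zeta^N=-1 .$$ With rank $\mathfrak r=\lfloor\frac{N-1}2\rfloor$, the short periods are, for $1\le j\le\mathfrak r$, $$a_j^{(s)}=\sum_{k=1}^{j}\left(R(\varepsilon^{4k-1})-R(\varepsilon^{4k-3})\right),\qquad a_{D,j}^{(s)}=R(\varepsilon^{4j+1})-R(\varepsilon^{4j-1}),$$ and the intrinsic Kähler potential is $$K_{\rm AD}=\frac{i}{4\pi}\sum_{j=1}^{\mathfrak r}\left(a_j^{(s)}\,\overline{a_{D,j}^{(s)}}-\overline{a_j^{(s)}}\,a_{D,j}^{(s)}\right).$$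 *)

theory Defs
  imports "HOL-Analysis.Analysis"
begin

text \<open>
  Throughout, \<open>v\<close> is a nonzero complex number and \<open>l\<close> is the chosen value of \<open>log v\<close>,
  that is \<open>exp l = v\<close>; the power \<open>v^a\<close> taken with this branch is \<open>vpow l a\<close>.
\<close>

definition vpow :: "complex \<Rightarrow> real \<Rightarrow> complex" where
  "vpow l a = exp (of_real a * l)"

text \<open>Right-hand side of the curve \<open>y^2 = x^N - (\<Sum>n=1..N-2. u n * x^n) + v\<close>.\<close>

definition sw_curve :: "nat \<Rightarrow> (nat \<Rightarrow> complex) \<Rightarrow> complex \<Rightarrow> complex \<Rightarrow> complex" where
  "sw_curve N u v x = x ^ N - (\<Sum>n=1..N-2. u n * x ^ n) + v"

definition scaled_coeff :: "nat \<Rightarrow> (nat \<Rightarrow> complex) \<Rightarrow> complex \<Rightarrow> nat \<Rightarrow> complex" where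
  "scaled_coeff N u l n = vpow l (real n / real N - 1) * u n"

definition scaled_poly :: "nat \<Rightarrow> (nat \<Rightarrow> complex) \<Rightarrow> complex \<Rightarrow> complex \<Rightarrow> complex" where
  "scaled_poly N u l z = z ^ N - (\<Sum>n=1..N-2. scaled_coeff N u l n * z ^ n) + 1"

text \<open>
  The radius \<open>sin (pi / N)\<close> is half the distance between neighbouring \<open>N\<close>-th roots of \<open>-1\<close>.
  For small scaled coefficients the ball of this radius around such a root \<open>\<zeta>\<close> contains exactly
  one zero of the scaled polynomial, and the neighbourhood of this radius of the segment
  from \<open>0\<close> to \<open>\<zeta>\<close> contains no other zero, so the same radius also bounds the
  admissible deformations of the segment below.
\<close>

definition near_radius :: "nat \<Rightarrow> real" where
  "near_radius N = sin (pi / real N)"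

definition root_near :: "nat \<Rightarrow> (nat \<Rightarrow> complex) \<Rightarrow> complex \<Rightarrow> complex \<Rightarrow> complex" where
  "root_near N u l \<zeta> = (THE z. z \<in> ball \<zeta> (near_radius N) \<and> scaled_poly N u l z = 0)"

text \<open>
  \<open>\<gamma>\<close> is a path in the \<open>z\<close>-plane and \<open>y\<close> the continuation along it, as a function of the path
  parameter, of the square root that defines the curve at \<open>x = v^(1/N) z\<close>.
\<close>

definition lifted_path ::
  "nat \<Rightarrow> (nat \<Rightarrow> complex) \<Rightarrow> complex \<Rightarrow> complex \<Rightarrow> complex \<Rightarrow> (real \<Rightarrow> complex) \<Rightarrow> (real \<Rightarrow> complex) \<Rightarrow> bool"
where
  "lifted_path N u v l \<zeta> \<gamma> y \<longleftrightarrow>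
     valid_path \<gamma> \<and> pathstart \<gamma> = 0 \<and> pathfinish \<gamma> = root_near N u l \<zeta> \<and>
     (\<forall>t\<in>{0..1}. dist (\<gamma> t) (linepath 0 \<zeta> t) < near_radius N) \<and>
     continuous_on {0..1} y \<and> y 0 = vpow l (1/2) \<and>
     (\<forall>t\<in>{0..1}. (y t)\<^sup>2 = sw_curve N u v (vpow l (1 / real N) * \<gamma> t)) \<and>
     (\<forall>t\<in>{0..<1}. y t \<noteq> 0)"

text \<open>
  The integral of \<open>sqrt (-2) y dx\<close> along a lifted path, with \<open>sqrt (-2) = - \<i> sqrt 2\<close>.
  An explicit integral is used because \<open>y\<close> is a function of the path parameter, not of the
  point on the path.
\<close>

definition has_sw_integral ::
  "complex \<Rightarrow> nat \<Rightarrow> (real \<Rightarrow> complex) \<Rightarrow> (real \<Rightarrow> complex) \<Rightarrow> complex \<Rightarrow> bool"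
where
  "has_sw_integral l N \<gamma> y I \<longleftrightarrow>
     ((\<lambda>t. - \<i> * of_real (sqrt 2) * y t *
           vector_derivative (\<lambda>s. vpow l (1 / real N) * \<gamma> s) (at t within {0..1}))
        has_integral I) {0..1}"

definition R_period ::
  "nat \<Rightarrow> (nat \<Rightarrow> complex) \<Rightarrow> complex \<Rightarrow> complex \<Rightarrow> complex \<Rightarrow> complex" where
  "R_period N u v l \<zeta> =
     (THE r. \<exists>\<gamma> y. lifted_path N u v l \<zeta> \<gamma> y \<and> has_sw_integral l N \<gamma> y (\<i> * of_real pi * r))"

text \<open>Only the values with index below \<open>N\<close> matter; the others are set to \<open>0\<close> for uniqueness.\<close>

definition char_coeff :: "nat \<Rightarrow> (complex \<Rightarrow> complex) \<Rightarrow> nat \<Rightarrow> complex" where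
  "char_coeff N R =
     (THE c. (\<forall>n\<ge>N. c n = 0) \<and>
             (\<forall>\<zeta>. \<zeta> ^ N = -1 \<longrightarrow> R \<zeta> = (\<Sum>n<N. \<zeta> ^ n * c n)))"

definition eps :: "nat \<Rightarrow> complex" where
  "eps N = exp (2 * of_real pi * \<i> / (2 * of_nat N))"

definition AD_rank :: "nat \<Rightarrow> nat" where
  "AD_rank N = (N - 1) div 2"

definition short_a :: "nat \<Rightarrow> (complex \<Rightarrow> complex) \<Rightarrow> nat \<Rightarrow> complex" where
  "short_a N R j = (\<Sum>k=1..j. R (eps N ^ (4 * k - 1)) - R (eps N ^ (4 * k - 3)))"

definition short_aD :: "nat \<Rightarrow> (complex \<Rightarrow> complex) \<Rightarrow> nat \<Rightarrow> complex" where
  "short_aD N R j = R (eps N ^ (4 * j + 1)) - R (eps N ^ (4 * j - 1))"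

definition K_AD :: "nat \<Rightarrow> (nat \<Rightarrow> complex) \<Rightarrow> complex \<Rightarrow> complex \<Rightarrow> complex" where
  "K_AD N u v l =
     \<i> / (4 * of_real pi) *
     (\<Sum>j=1..AD_rank N.
        short_a N (R_period N u v l) j * cnj (short_aD N (R_period N u v l) j)
        - cnj (short_a N (R_period N u v l) j) * short_aD N (R_period N u v l) j)"

end

theory Submission
  imports Defs
begin

text \<open>
  The discrete Fourier transform over the roots of \<open>\<zeta>^N = -1\<close> makes \<open>K_AD\<close> a Hermitian form in the
  coefficients \<open>R_n\<close>, whose matrix entry at \<open>(n, m)\<close> depends on the angles \<open>x = \<pi> n / N\<close> and
  \<open>y = \<pi> m / N\<close>. Geometric summation turns the coefficient of \<open>R_n\<close> in \<open>a_j\<close> into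
  \<open>(e^(4ijx) - 1) / (2 cos x)\<close> and the one in \<open>a_{D,j}\<close> into \<open>2i sin x e^(4ijx)\<close>, so the entry reduces
  to the sums \<open>\<Sum>j=1..r. e^(4ijt)\<close>. These equal \<open>- (1 + i tan t) / 2\<close> for odd \<open>N\<close> and \<open>-1\<close> for even \<open>N\<close>
  (generic \<open>t\<close>), which makes the off-diagonal entries cancel. For \<open>N = 2\<nu>\<close> the
  angle of \<open>R_\<nu>\<close> is \<open>\<pi> / 2\<close>, where \<open>cos x = 0\<close> and \<open>a_j\<close> grows linearly in \<open>j\<close>; the sums
  \<open>\<Sum>j=1..r. j e^(4ijt)\<close> then give the mixed terms.
\<close>

text \<open>Coefficients of \<open>R_n\<close> in \<open>a_j\<close> and \<open>a_{D,j}\<close>, as functions of the angle \<open>x = \<pi> n / N\<close>.\<close>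

definition a_char :: "nat \<Rightarrow> real \<Rightarrow> complex" where
  "a_char j x = (\<Sum>k=1..j. cis ((4 * real k - 1) * x) - cis ((4 * real k - 3) * x))"

definition aD_char :: "nat \<Rightarrow> real \<Rightarrow> complex" where
  "aD_char j x = cis ((4 * real j + 1) * x) - cis ((4 * real j - 1) * x)"

text \<open>This is the matrix of the form \<open>4 * pi * K_AD\<close> in the coefficients
  \<open>R_n\<close>. The factor \<open>\<i>\<close> turns the antisymmetrised product into a
  Hermitian matrix.\<close>

definition kahler_kernel :: "nat \<Rightarrow> real \<Rightarrow> real \<Rightarrow> complex" where
  "kahler_kernel r x y =
     \<i> * (\<Sum>j=1..r. a_char j x * cnj (aD_char j y) - cnj (a_char j y) * aD_char j x)"

definition cis_sum :: "nat \<Rightarrow> real \<Rightarrow> complex" where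
  "cis_sum r x = (\<Sum>j=1..r. cis (4 * real j * x))"

section \<open>Closed forms of the period coefficients\<close>

lemma cis_minus_1: "cis (2 * x) - 1 = 2 * \<i> * of_real (sin x) * cis x"
  by (simp add: complex_eq_iff sin_double cos_double_sin power2_eq_square)

lemma cis_plus_1: "cis (2 * x) + 1 = 2 * of_real (cos x) * cis x"
  by (simp add: complex_eq_iff sin_double cos_double_cos power2_eq_square)

lemma aD_char_eq: "aD_char j x = 2 * \<i> * of_real (sin x) * cis (4 * real j * x)"
proof -
  have "aD_char j x = cis (4 * real j * x - x) * (cis (2 * x) - 1)"
    unfolding aD_char_def right_diff_distrib cis_mult by (simp add: algebra_simps)
  also have "\<dots> = 2 * \<i> * of_real (sin x) * (cis (4 * real j * x - x) * cis x)"
    unfolding cis_minus_1 by (simp only: mult_ac)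
  finally show ?thesis by (simp add: cis_mult)
qed

text \<open>The factor \<open>2 * cos x\<close> makes the sum telescope: it turns the k-th summand
  into \<open>cis (4 * k * x) - cis (4 * (k - 1) * x)\<close>. Keeping the factor on the left avoids
  division where the cosine vanishes.\<close>

lemma a_char_mult_cos: "2 * of_real (cos x) * a_char j x = cis (4 * real j * x) - 1"
proof (induction j)
  case 0
  show ?case by (simp add: a_char_def)
next
  case (Suc j)
  have "cis ((4 * real (Suc j) - 1) * x) - cis ((4 * real (Suc j) - 3) * x)
      = cis (4 * real j * x) * cis x * (cis (2 * x) - 1)"
    unfolding right_diff_distrib cis_mult by (simp add: algebra_simps)
  then have "2 * of_real (cos x) * a_char (Suc j) x =
      2 * of_real (cos x) * a_char j x
      + (2 * of_real (cos x) * cis x) * cis (4 * real j * x) * (cis (2 * x) - 1)"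
    by (simp add: a_char_def distrib_left)
  also have "\<dots> = cis (4 * real j * x) - 1 + (cis (2 * x) + 1) * cis (4 * real j * x) * (cis (2 * x) - 1)"
    by (simp only: Suc.IH cis_plus_1)
  also have "\<dots> = cis (4 * real j * x) * (cis (2 * x) * cis (2 * x)) - 1"
    by algebra
  also have "\<dots> = cis (4 * real (Suc j) * x) - 1"
    unfolding cis_mult by (simp add: algebra_simps)
  finally show ?case .
qed

lemma a_char_eq:
  assumes "cos x \<noteq> 0"
  shows "a_char j x = (cis (4 * real j * x) - 1) / (2 * of_real (cos x))"
  using a_char_mult_cos[of x j] assms by (simp add: field_simps)

lemma cis_mult_2pi: "cis (2 * pi * real k) = 1"
  by (metis Complex.DeMoivre cis_2pi power_one mult.commute)

lemma a_char_pi_half: "a_char j (pi / 2) = - 2 * \<i> * of_nat j"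
proof -
  have "cis ((4 * real k - 1) * (pi / 2)) - cis ((4 * real k - 3) * (pi / 2)) = - 2 * \<i>" for k
  proof -
    have "(4 * real k - 1) * (pi / 2) = 2 * pi * real k + - (pi / 2)"
      "(4 * real k - 3) * (pi / 2) = 2 * pi * real k + (pi / 2 + - (2 * pi))"
      by (simp_all add: field_simps)
    then show ?thesis
      by (simp only: cis_mult[symmetric] cis_mult_2pi) (simp add: complex_eq_iff)
  qed
  then show ?thesis by (simp add: a_char_def)
qed

lemma aD_char_pi_half: "aD_char j (pi / 2) = 2 * \<i>"
proof -
  have "4 * real j * (pi / 2) = 2 * pi * real j" by simp
  then show ?thesis by (simp only: aD_char_eq cis_mult_2pi) simp
qed

section \<open>Reduction of the kernel to geometric sums\<close>

text \<open>At angle 0 all differences of phases cancel, so \<open>R_0\<close> drops out of the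
  potential.\<close>

lemma kahler_kernel_0 [simp]: "kahler_kernel r 0 y = 0" "kahler_kernel r x 0 = 0"
  by (simp_all add: kahler_kernel_def a_char_def aD_char_def)

lemma kahler_kernel_swap: "kahler_kernel r y x = cnj (kahler_kernel r x y)"
  unfolding kahler_kernel_def complex_cnj_mult cnj_sum sum_distrib_left
  by (intro sum.cong refl) (simp add: algebra_simps)

text \<open>After inserting the closed forms, each product of phases depends on j only through
  \<open>x - y\<close>, \<open>x\<close> or \<open>- y\<close>, so summing over j leaves three
  geometric sums.\<close>

lemma kahler_kernel_eq:
  assumes "cos x \<noteq> 0" "cos y \<noteq> 0"
  shows "kahler_kernel r x y =
    of_real (sin y / cos x) * (cis_sum r (x - y) - cis_sum r (- y))
    + of_real (sin x / cos y) * (cis_sum r (x - y) - cis_sum r x)"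
proof -
  have "\<i> * (a_char j x * cnj (aD_char j y) - cnj (a_char j y) * aD_char j x) =
     of_real (sin y / cos x) * (cis (4 * real j * (x - y)) - cis (4 * real j * (- y)))
    + of_real (sin x / cos y) * (cis (4 * real j * (x - y)) - cis (4 * real j * x))" for j
  proof -
    let ?X = "cis (4 * real j * x)" and ?Y = "cis (- (4 * real j * y))"
    have XY: "cis (4 * real j * (x - y)) = ?X * ?Y"
      by (simp add: cis_mult algebra_simps)
    have Y: "cis (4 * real j * (- y)) = ?Y" by simp
    have cX: "complex_of_real (cos x) \<noteq> 0" "complex_of_real (cos y) \<noteq> 0" using assms by simp_all
    show ?thesis
      unfolding XY Y a_char_eq[OF assms(1)] a_char_eq[OF assms(2)] aD_char_eq
      using cX by (simp add: cis_cnj field_simps)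
  qed
  then show ?thesis
    unfolding kahler_kernel_def cis_sum_def sum_subtractf[symmetric] sum_distrib_left
      sum.distrib[symmetric] by (intro sum.cong refl)
qed

section \<open>Evaluation of the geometric sums\<close>

lemma cis_sum_mult: "(cis (4 * x) - 1) * cis_sum r x = cis (4 * real (Suc r) * x) - cis (4 * x)"
  by (induction r) (simp_all add: cis_sum_def algebra_simps cis_mult)

text \<open>With \<open>N = 2 * r + 1\<close>, periodicity reduces the numerator of the geometric
  sum to \<open>cis (2 * x) - cis (4 * x)\<close>. Cancelling \<open>cis (2 * x) - 1\<close> leaves
  \<open>- cis x / (2 * cos x)\<close>.\<close>

lemma cis_sum_odd:
  assumes "cis (2 * real (2 * r + 1) * x) = 1" "sin x \<noteq> 0" "cos x \<noteq> 0"
  shows "cis_sum r x = - (1 + \<i> * of_real (tan x)) / 2"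
proof -
  have "4 * real (Suc r) * x = 2 * real (2 * r + 1) * x + 2 * x" by (simp add: algebra_simps)
  then have "cis (4 * real (Suc r) * x) = cis (2 * x)"
    by (simp only: cis_mult[symmetric] assms(1) mult_1_left)
  moreover have *: "cis (4 * x) = cis (2 * x) * cis (2 * x)" by (simp add: cis_mult)
  ultimately have "(cis (2 * x) - 1) * ((cis (2 * x) + 1) * cis_sum r x + cis (2 * x)) = 0"
    using cis_sum_mult[of x r] by (simp add: algebra_simps)
  moreover have "cis (2 * x) - 1 \<noteq> 0" using assms(2) by (simp add: cis_minus_1)
  ultimately have "(cis (2 * x) + 1) * cis_sum r x = - cis (2 * x)"
    by (simp add: eq_neg_iff_add_eq_0)
  then have "(2 * of_real (cos x) * cis x) * cis_sum r x = - (cis x * cis x)"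
    by (simp add: cis_plus_1 cis_mult)
  then have "cis x * (2 * of_real (cos x) * cis_sum r x + cis x) = 0"
    by (simp add: algebra_simps)
  then have "2 * of_real (cos x) * cis_sum r x = - cis x"
    by (simp add: eq_neg_iff_add_eq_0)
  moreover have "cis x = of_real (cos x) * (1 + \<i> * of_real (tan x))"
    using assms(3) by (simp add: complex_eq_iff tan_def)
  ultimately have "of_real (cos x) * (2 * cis_sum r x + (1 + \<i> * of_real (tan x))) = 0"
    by (simp add: algebra_simps)
  then have "2 * cis_sum r x + (1 + \<i> * of_real (tan x)) = 0"
    using assms(3) by (simp only: mult_eq_0_iff of_real_eq_0_iff simp_thms)
  then have "2 * cis_sum r x = - (1 + \<i> * of_real (tan x))"
    by (simp only: eq_neg_iff_add_eq_0)
  then show ?thesis by (metis nonzero_mult_div_cancel_left zero_neq_numeral)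
qed

text \<open>With \<open>N = 2 * Suc r\<close>, the phases for \<open>j = 0..r\<close> run through
  all powers of a root of unity different from 1 and sum to 0; the sum here lacks only the term 1 at
  \<open>j = 0\<close>.\<close>

lemma cis_sum_even:
  assumes "cis (4 * real (Suc r) * x) = 1" "cis (4 * x) \<noteq> 1"
  shows "cis_sum r x = - 1"
proof -
  have "(cis (4 * x) - 1) * (cis_sum r x + 1) = 0"
    using cis_sum_mult[of x r] assms(1) by (simp add: algebra_simps)
  with assms(2) show ?thesis by (simp add: eq_neg_iff_add_eq_0)
qed

text \<open>Summation by parts; the weight j comes from the linear growth of \<open>a_char\<close>
  at \<open>pi / 2\<close>.\<close>

lemma sum_nat_mult_cis:
  "(cis (4 * x) - 1) * (\<Sum>j=1..r. of_nat j * cis (4 * real j * x)) =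
     of_nat r * cis (4 * real (Suc r) * x) - cis_sum r x"
  by (induction r) (simp_all add: cis_sum_def algebra_simps cis_mult)

text \<open>A zero cosine would give \<open>cis (2 * x) = - 1\<close>, whose odd power is again -1.
  Hence for odd N the closed forms apply to all angles and to their differences.\<close>

lemma cos_nonzero_if_odd:
  assumes "odd N" "cis (2 * real N * x) = 1"
  shows "cos x \<noteq> 0"
proof
  assume "cos x = 0"
  then have "cis (2 * x) = - 1" using cis_plus_1[of x] by (simp add: eq_neg_iff_add_eq_0)
  then have "cis (real N * (2 * x)) = - 1"
    using assms(1) by (simp add: Complex.DeMoivre[symmetric])
  then show False using assms(2) by (simp add: mult_ac)
qed

lemma cis_power_eq_1_minus:
  assumes "cis (a * x) = 1"
  shows "cis (a * (- x)) = 1"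
  using assms by (simp add: cis_inverse[symmetric])

lemma cis_power_eq_1_diff:
  assumes "cis (a * x) = 1" "cis (a * y) = 1"
  shows "cis (a * (x - y)) = 1"
  using assms by (simp add: right_diff_distrib cis_divide[symmetric])

lemma cis_sum_0 [simp]: "cis_sum r 0 = of_nat r"
  by (simp add: cis_sum_def)

section \<open>Kernel entries for odd N\<close>

text \<open>The sum at the zero difference is r, and it occurs twice; the tangents at
  \<open>x\<close> and \<open>- x\<close> cancel, and their real parts supply the last unit of
  \<open>2 * r + 1\<close>.\<close>

lemma kahler_kernel_odd_diag:
  assumes "cis (2 * real (2 * r + 1) * x) = 1" "sin x \<noteq> 0"
  shows "kahler_kernel r x x = of_real (real (2 * r + 1) * (sin x / cos x))"
proof -
  have c: "cos x \<noteq> 0" by (rule cos_nonzero_if_odd[OF _ assms(1)]) simp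
  have G: "cis_sum r x = - (1 + \<i> * of_real (tan x)) / 2"
    "cis_sum r (- x) = - (1 + \<i> * of_real (tan (- x))) / 2"
    using assms c cis_power_eq_1_minus[OF assms(1)] by (intro cis_sum_odd; simp)+
  have "kahler_kernel r x x = of_real (sin x / cos x) * (2 * of_nat r - (cis_sum r x + cis_sum r (- x)))"
    unfolding kahler_kernel_eq[OF c c] distrib_left[symmetric] by simp
  also have "cis_sum r x + cis_sum r (- x) = - 1"
    unfolding G by (simp add: field_simps)
  finally show ?thesis by (simp add: algebra_simps)
qed

text \<open>The real parts of the geometric sums cancel in each bracket. By tangent addition the
  remaining two terms are opposite multiples of
  \<open>sin x * sin y / (cos x * cos y * cos (x - y))\<close>.\<close>

lemma kahler_kernel_odd_off_diag:
  assumes "cis (2 * real (2 * r + 1) * x) = 1" "cis (2 * real (2 * r + 1) * y) = 1"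
    and "sin x \<noteq> 0" "sin y \<noteq> 0" "sin (x - y) \<noteq> 0"
  shows "kahler_kernel r x y = 0"
proof -
  note d = cis_power_eq_1_diff[OF assms(1,2)]
  have c: "cos x \<noteq> 0" "cos y \<noteq> 0" "cos (x - y) \<noteq> 0"
    by (rule cos_nonzero_if_odd[OF _ assms(1)] cos_nonzero_if_odd[OF _ assms(2)]
        cos_nonzero_if_odd[OF _ d], simp)+
  have G: "cis_sum r x = - (1 + \<i> * of_real (tan x)) / 2"
    "cis_sum r (- y) = - (1 + \<i> * of_real (tan (- y))) / 2"
    "cis_sum r (x - y) = - (1 + \<i> * of_real (tan (x - y))) / 2"
    using assms c d cis_power_eq_1_minus[OF assms(2)] by (intro cis_sum_odd; simp)+
  have "sin y / cos x * (tan (x - y) + tan y) + sin x / cos y * (tan (x - y) - tan x) = 0"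
  proof -
    have "tan (x - y) + tan y = sin x / (cos (x - y) * cos y)"
      using add_tan_eq[of "x - y" y] c by simp
    moreover have "tan (x - y) - tan x = - sin y / (cos (x - y) * cos x)"
      using add_tan_eq[of "x - y" "- x"] c by simp
    ultimately show ?thesis by simp
  qed
  then have "complex_of_real (sin y / cos x * (tan (x - y) + tan y) + sin x / cos y * (tan (x - y) - tan x)) = 0"
    by (simp only: of_real_0)
  moreover have "kahler_kernel r x y = - \<i> / 2 * complex_of_real
     (sin y / cos x * (tan (x - y) + tan y) + sin x / cos y * (tan (x - y) - tan x))"
  proof -
    have "cis_sum r (x - y) - cis_sum r (- y) = - \<i> / 2 * of_real (tan (x - y) + tan y)"
      "cis_sum r (x - y) - cis_sum r x = - \<i> / 2 * of_real (tan (x - y) - tan x)"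
      unfolding G by (simp_all add: field_simps)
    note e = this
    show ?thesis
      unfolding kahler_kernel_eq[OF c(1,2)] e
      by (simp only: of_real_add of_real_mult) (simp only: distrib_left mult_ac)
  qed
  ultimately show ?thesis by simp
qed

section \<open>Kernel entries for even N\<close>

lemma cis_4_neq_1:
  assumes "sin x \<noteq> 0" "cos x \<noteq> 0"
  shows "cis (4 * x) \<noteq> 1"
  using cis_minus_1[of "2 * x"] assms by (auto simp: sin_double)

lemma kahler_kernel_even_diag:
  assumes "cis (4 * real (Suc r) * x) = 1" "sin x \<noteq> 0" "cos x \<noteq> 0"
  shows "kahler_kernel r x x = of_real (2 * real (Suc r) * (sin x / cos x))"
proof -
  have "cis_sum r x = - 1" "cis_sum r (- x) = - 1"
    using assms cis_power_eq_1_minus[OF assms(1)] cis_4_neq_1[of x] cis_4_neq_1[of "- x"]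
    by (intro cis_sum_even; simp)+
  then show ?thesis
    using assms by (simp add: kahler_kernel_eq field_simps)
qed

text \<open>Generically all three geometric sums are -1 and both brackets vanish. The exception is a
  difference of a quarter turn, where the sum at \<open>x - y\<close> is not -1 and the prefactors
  must cancel instead.\<close>

lemma kahler_kernel_even_off_diag:
  assumes "cis (4 * real (Suc r) * x) = 1" "cis (4 * real (Suc r) * y) = 1"
    and "sin x \<noteq> 0" "cos x \<noteq> 0" "sin y \<noteq> 0" "cos y \<noteq> 0" "sin (x - y) \<noteq> 0"
  shows "kahler_kernel r x y = 0"
proof -
  have G: "cis_sum r x = - 1" "cis_sum r (- y) = - 1"
    using assms cis_power_eq_1_minus[OF assms(2)] cis_4_neq_1[of x] cis_4_neq_1[of "- y"]
    by (intro cis_sum_even; simp)+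
  show ?thesis
  proof (cases "cos (x - y) = 0")
    case False
    have "cis_sum r (x - y) = - 1"
      using cis_power_eq_1_diff[OF assms(1,2)] cis_4_neq_1[OF assms(7) False]
      by (rule cis_sum_even)
    then show ?thesis by (simp add: kahler_kernel_eq assms G)
  next
    case True
    have "sin x * cos x + sin y * cos y = sin (x + y) * cos (x - y)"
    proof -
      \<comment> \<open>The factors equal to 1 make both sides homogeneous of degree four, so that
        the identity is purely polynomial in the sines and cosines.\<close>
      have "sin x * cos x * ((sin y)\<^sup>2 + (cos y)\<^sup>2) + sin y * cos y * ((sin x)\<^sup>2 + (cos x)\<^sup>2)
          = sin (x + y) * cos (x - y)"
        unfolding sin_add cos_diff by algebra
      then show ?thesis by simp
    qed
    then have "sin y / cos x + sin x / cos y = 0"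
      using assms True by (simp add: field_simps)
    then have *: "complex_of_real (sin y / cos x) + of_real (sin x / cos y) = 0"
      by (metis of_real_0 of_real_add)
    \<comment> \<open>Both brackets are now \<open>cis_sum r (x - y) + 1\<close>, so the sum of the
      prefactors factors out.\<close>
    show ?thesis
      unfolding kahler_kernel_eq[OF assms(4,6)] G
      by (simp only: distrib_right[symmetric] *) simp
  qed
qed

text \<open>The linear growth of \<open>a_char\<close> at \<open>pi / 2\<close> contributes the
  weighted sum \<open>S\<close>, and the constant \<open>aD_char\<close> an ordinary geometric sum.
  They supply the terms \<open>cis (2 * y)\<close> and \<open>- 1\<close> of the numerator
  respectively.\<close>

lemma kahler_kernel_pi_half:
  assumes "cis (4 * real (Suc r) * y) = 1" "sin y \<noteq> 0" "cos y \<noteq> 0"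
  shows "kahler_kernel r (pi / 2) y = of_nat (Suc r) * (cis (2 * y) - 1) / of_real (cos y)"
proof -
  define S where "S = (\<Sum>j=1..r. of_nat j * cis (4 * real j * (- y)))"
  have c: "complex_of_real (cos y) \<noteq> 0" using assms by simp
  have G: "cis_sum r (- y) = - 1"
    using assms cis_power_eq_1_minus[OF assms(1)] cis_4_neq_1[of "- y"]
    by (intro cis_sum_even; simp)
  \<comment> \<open>The boundary term r of the summation by parts and the value -1 of the geometric
    sum combine to \<open>Suc r\<close>.\<close>
  have "(cis (4 * (- y)) - 1) * S = of_nat (Suc r)"
    unfolding S_def sum_nat_mult_cis G cis_power_eq_1_minus[OF assms(1)] by simp
  moreover have "cis (4 * (- y)) - 1 = - 4 * \<i> * of_real (sin y) * of_real (cos y) * cis (- (2 * y))"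
    using cis_minus_1[of "- 2 * y"] by (simp add: sin_double)
  ultimately have *: "- 4 * \<i> * of_real (sin y) * of_real (cos y) * cis (- (2 * y)) * S = of_nat (Suc r)"
    by simp
  have "- 4 * \<i> * of_real (sin y) * of_real (cos y) * S =
      - 4 * \<i> * of_real (sin y) * of_real (cos y) * S * (cis (- (2 * y)) * cis (2 * y))"
    by (simp add: cis_mult)
  also have "\<dots> = (- 4 * \<i> * of_real (sin y) * of_real (cos y) * cis (- (2 * y)) * S) * cis (2 * y)"
    by (simp only: mult_ac)
  also have "\<dots> = of_nat (Suc r) * cis (2 * y)"
    by (simp only: *)
  finally have S: "- 4 * \<i> * of_real (sin y) * of_real (cos y) * S = of_nat (Suc r) * cis (2 * y)" .
  have "\<i> * (a_char j (pi / 2) * cnj (aD_char j y) - cnj (a_char j y) * aD_char j (pi / 2)) =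
    - 4 * \<i> * of_real (sin y) * (of_nat j * cis (4 * real j * (- y)))
    + (cis (4 * real j * (- y)) - 1) / of_real (cos y)" for j
    unfolding a_char_pi_half aD_char_pi_half a_char_eq[OF assms(3)] aD_char_eq[of _ y]
    using c by (simp add: cis_cnj field_simps)
  then have "kahler_kernel r (pi / 2) y =
      - 4 * \<i> * of_real (sin y) * S + (cis_sum r (- y) - of_nat r) / of_real (cos y)"
    unfolding kahler_kernel_def S_def cis_sum_def sum_distrib_left
    by (simp add: sum.distrib sum_subtractf sum_divide_distrib[symmetric] sum_negf)
  then have "of_real (cos y) * kahler_kernel r (pi / 2) y =
      - 4 * \<i> * of_real (sin y) * of_real (cos y) * S + (cis_sum r (- y) - of_nat r)"
    using c by (simp add: field_simps)
  then show ?thesis unfolding S G using c by (simp add: field_simps)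
qed

text \<open>The product of \<open>a_char\<close> with the conjugate of \<open>aD_char\<close> is the
  real number \<open>- 4 * j\<close>, so it cancels against its conjugate.\<close>

lemma kahler_kernel_pi_half_diag: "kahler_kernel r (pi / 2) (pi / 2) = 0"
  by (simp add: kahler_kernel_def a_char_pi_half aD_char_pi_half)

section \<open>Fourier expansion over the roots of -1\<close>

text \<open>Existence is Fourier inversion, since quotients of two roots of -1 are N-th roots of
  unity. Uniqueness, needed to unfold the definite description, is the bound on the number of roots
  of a polynomial.\<close>

lemma char_coeff:
  assumes "0 < N" "\<zeta> ^ N = - 1"
  shows "R \<zeta> = (\<Sum>n<N. \<zeta> ^ n * char_coeff N R n)"
proof -
  define Z where "Z = {z::complex. z ^ N = - 1}"
  have card: "card Z = N" unfolding Z_def using assms by (intro card_nth_roots) auto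
  then have fin: "finite Z" using assms card_ge_0_finite by metis
  let ?P = "\<lambda>c. (\<forall>n\<ge>N. c n = 0) \<and> (\<forall>\<zeta>. \<zeta> ^ N = -1 \<longrightarrow> R \<zeta> = (\<Sum>n<N. \<zeta> ^ n * c n))"
  \<comment> \<open>The inverse transform: values of \<open>R\<close> averaged against
    \<open>w ^ n\<close> in the denominator, with 0 from index N on as the normalisation
    demands.\<close>
  define d where "d = (\<lambda>n. if n < N then (\<Sum>w\<in>Z. R w / w ^ n) / of_nat N else 0)"
  have "R z = (\<Sum>n<N. z ^ n * d n)" if z: "z ^ N = - 1" for z
  proof -
    have geo: "(\<Sum>n<N. (z / w) ^ n) = (if z = w then of_nat N else 0)" if "w \<in> Z" for w
    proof -
      have w: "w ^ N = - 1" using that by (simp add: Z_def)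
      then have "w \<noteq> 0" using assms(1) by (auto simp: power_0_left)
      moreover have "(z / w) ^ N = 1" using z w by (simp add: power_divide)
      ultimately show ?thesis using assms(1) by (auto simp: geometric_sum)
    qed
    have "(\<Sum>n<N. z ^ n * d n) = (\<Sum>n<N. \<Sum>w\<in>Z. R w / of_nat N * (z / w) ^ n)"
      by (intro sum.cong refl)
        (simp add: d_def sum_distrib_left sum_divide_distrib power_divide mult_ac)
    also have "\<dots> = (\<Sum>w\<in>Z. R w / of_nat N * (\<Sum>n<N. (z / w) ^ n))"
      by (subst sum.swap) (simp add: sum_distrib_left)
    also have "\<dots> = (\<Sum>w\<in>Z. if z = w then R w else 0)"
      using assms(1) by (intro sum.cong refl) (simp add: geo)
    also have "\<dots> = R z" using z fin by (simp add: Z_def)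
    finally show ?thesis by simp
  qed
  then have d: "?P d" by (simp add: d_def)
  moreover have "c = d" if c: "?P c" for c
  proof
    fix k
    show "c k = d k"
    proof (rule ccontr)
      assume k: "c k \<noteq> d k"
      with c d have kN: "k \<le> N - 1" by (metis Suc_pred' assms(1) leI less_Suc_eq_le)
      have atMost: "{..N - 1} = {..<N}" using assms(1) by auto
      \<comment> \<open>Two expansions differ by a polynomial of degree at most \<open>N - 1\<close>
        that vanishes at all N points of \<open>Z\<close>.\<close>
      have "Z \<subseteq> {z. (\<Sum>n\<le>N - 1. (c n - d n) * z ^ n) = 0}"
      proof
        fix z
        assume "z \<in> Z"
        then have "(\<Sum>n<N. z ^ n * c n) - (\<Sum>n<N. z ^ n * d n) = 0"
          using c d by (simp add: Z_def)
        then show "z \<in> {z. (\<Sum>n\<le>N - 1. (c n - d n) * z ^ n) = 0}"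
          unfolding atMost by (simp add: algebra_simps sum_subtractf)
      qed
      moreover have "finite {z. (\<Sum>n\<le>N - 1. (c n - d n) * z ^ n) = 0} \<and>
          card {z. (\<Sum>n\<le>N - 1. (c n - d n) * z ^ n) = 0} \<le> N - 1"
        using k kN by (intro polyfun_rootbound) auto
      ultimately have "card Z \<le> N - 1" by (meson card_mono order_trans)
      with card assms(1) show False by simp
    qed
  qed
  ultimately have "\<exists>!c. ?P c" by blast
  then have "?P (char_coeff N R)" unfolding char_coeff_def by (rule theI')
  with assms(2) show ?thesis by blast
qed

section \<open>Short periods and potential in terms of the coefficients\<close>

lemma eps_power: "eps N ^ k = cis (real k * (pi / real N))"
proof -
  have "eps N = cis (pi / real N)" by (simp add: eps_def cis_conv_exp mult_ac)
  then show ?thesis by (simp add: Complex.DeMoivre)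
qed

lemma R_eps_power:
  assumes "0 < N" "odd k"
  shows "R (eps N ^ k) = (\<Sum>n<N. char_coeff N R n * cis (real k * (pi * real n / real N)))"
proof -
  have "(eps N ^ k) ^ N = cis pi ^ k"
    using assms(1) by (simp add: eps_power Complex.DeMoivre del: cis_pi)
  then have "(eps N ^ k) ^ N = - 1" using assms(2) by simp
  then have "R (eps N ^ k) = (\<Sum>n<N. (eps N ^ k) ^ n * char_coeff N R n)"
    by (rule char_coeff[OF assms(1)])
  then show ?thesis by (simp add: eps_power Complex.DeMoivre mult_ac)
qed

lemma short_a_eq:
  assumes "0 < N"
  shows "short_a N R j = (\<Sum>n<N. char_coeff N R n * a_char j (pi * real n / real N))"
proof -
  have "R (eps N ^ (4 * k - 1)) - R (eps N ^ (4 * k - 3)) = (\<Sum>n<N. char_coeff N R n *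
      (cis ((4 * real k - 1) * (pi * real n / real N)) - cis ((4 * real k - 3) * (pi * real n / real N))))"
    if "k \<in> {1..j}" for k
  proof -
    \<comment> \<open>The bound \<open>1 \<le> k\<close> makes the natural-number subtractions
      exact; both exponents are odd, so the expansion applies at these powers.\<close>
    have k: "real (4 * k - 1) = 4 * real k - 1" "real (4 * k - 3) = 4 * real k - 3"
      "odd (4 * k - 1)" "odd (4 * k - 3)"
      using that by (auto simp: of_nat_diff)
    show ?thesis
      by (simp only: R_eps_power[OF assms k(3)] R_eps_power[OF assms k(4)] k(1,2)
          sum_subtractf right_diff_distrib)
  qed
  then show ?thesis
    unfolding short_a_def a_char_def sum_distrib_left by (subst sum.swap) simp
qed

lemma short_aD_eq:
  assumes "0 < N" "1 \<le> j"
  shows "short_aD N R j = (\<Sum>n<N. char_coeff N R n * aD_char j (pi * real n / real N))"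
proof -
  have k: "real (4 * j + 1) = 4 * real j + 1" "real (4 * j - 1) = 4 * real j - 1"
    "odd (4 * j + 1)" "odd (4 * j - 1)"
    using assms(2) by (auto simp: of_nat_diff)
  show ?thesis
    unfolding short_aD_def aD_char_def
    by (simp only: R_eps_power[OF assms(1) k(3)] R_eps_power[OF assms(1) k(4)] k(1,2)
        sum_subtractf right_diff_distrib)
qed

lemma K_AD_eq:
  assumes "0 < N"
  defines "x \<equiv> \<lambda>n::nat. pi * real n / real N"
  shows "K_AD N u v l = of_real (1 / (4 * pi)) *
    (\<Sum>n<N. \<Sum>m<N. char_coeff N (R_period N u v l) n * cnj (char_coeff N (R_period N u v l) m) *
       kahler_kernel (AD_rank N) (x n) (x m))"
proof -
  define f where "f = char_coeff N (R_period N u v l)"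
  have "short_a N (R_period N u v l) j * cnj (short_aD N (R_period N u v l) j)
      - cnj (short_a N (R_period N u v l) j) * short_aD N (R_period N u v l) j =
    (\<Sum>n<N. \<Sum>m<N. f n * cnj (f m) *
      (a_char j (x n) * cnj (aD_char j (x m)) - cnj (a_char j (x m)) * aD_char j (x n)))"
    if "j \<in> {1..AD_rank N}" for j
  proof -
    have "cnj (short_a N (R_period N u v l) j) * short_aD N (R_period N u v l) j =
      (\<Sum>n<N. \<Sum>m<N. f n * cnj (f m) * (cnj (a_char j (x m)) * aD_char j (x n)))"
      using that assms(1) unfolding f_def x_def
      by (simp add: short_a_eq short_aD_eq sum_product mult_ac)
    moreover have "short_a N (R_period N u v l) j * cnj (short_aD N (R_period N u v l) j) =
      (\<Sum>n<N. \<Sum>m<N. f n * cnj (f m) * (a_char j (x n) * cnj (aD_char j (x m))))"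
      using that assms(1) unfolding f_def x_def
      by (simp add: short_a_eq short_aD_eq sum_product mult_ac)
    ultimately show ?thesis by (simp add: sum_subtractf right_diff_distrib)
  qed
  then have "K_AD N u v l = \<i> / (4 * of_real pi) * (\<Sum>j=1..AD_rank N. \<Sum>n<N. \<Sum>m<N. f n * cnj (f m) *
      (a_char j (x n) * cnj (aD_char j (x m)) - cnj (a_char j (x m)) * aD_char j (x n)))"
    unfolding K_AD_def by simp
  also have "(\<Sum>j=1..AD_rank N. \<Sum>n<N. \<Sum>m<N. f n * cnj (f m) *
      (a_char j (x n) * cnj (aD_char j (x m)) - cnj (a_char j (x m)) * aD_char j (x n))) =
     (\<Sum>n<N. \<Sum>m<N. f n * cnj (f m) * (\<Sum>j=1..AD_rank N.
      (a_char j (x n) * cnj (aD_char j (x m)) - cnj (a_char j (x m)) * aD_char j (x n))))"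
    unfolding sum_distrib_left by (subst sum.swap, subst (2) sum.swap) simp
  finally show ?thesis
    unfolding f_def[symmetric] kahler_kernel_def by (simp add: sum_distrib_left mult_ac)
qed

section \<open>Nondegeneracy of the angles and assembly of the two cases\<close>

text \<open>All angles lie in \<open>[0, pi)\<close>, so a difference with zero sine is 0. Taking
  \<open>m = 0\<close> bounds sines away from 0, and \<open>m = \<nu>\<close> does the same for
  cosines when \<open>N = 2 * \<nu>\<close>.\<close>

lemma sin_diff_angles:
  assumes "n < N" "m < N" "n \<noteq> m"
  shows "sin (pi * real n / real N - pi * real m / real N) \<noteq> 0"
proof
  assume *: "sin (pi * real n / real N - pi * real m / real N) = 0"
  have "pi * real n < pi * real N" "pi * real m < pi * real N" using assms by simp_all
  then have "0 \<le> pi * real n / real N" "pi * real n / real N < pi"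
    "0 \<le> pi * real m / real N" "pi * real m / real N < pi"
    using assms by (simp_all add: field_simps)
  then have "pi * real n / real N - pi * real m / real N = 0"
    by (intro sin_eq_0_pi[OF _ _ *]) linarith+
  then have "pi * (real n - real m) / real N = 0"
    by (simp add: right_diff_distrib diff_divide_distrib)
  then show False using assms by simp
qed

lemma cis_angle_period:
  assumes "0 < N"
  shows "cis (2 * real N * (pi * real n / real N)) = 1"
  using assms cis_mult_2pi[of n] by (simp add: mult_ac)

lemma sum_hermitian_diag:
  fixes f :: "nat \<Rightarrow> complex"
  assumes "finite A" "\<And>n m. n \<in> A \<Longrightarrow> m \<in> A \<Longrightarrow> M n m = (if n = m then of_real (a n) else 0)"
  shows "(\<Sum>n\<in>A. \<Sum>m\<in>A. f n * cnj (f m) * M n m) = of_real (\<Sum>n\<in>A. a n * (cmod (f n))\<^sup>2)"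
proof -
  have "(\<Sum>m\<in>A. f n * cnj (f m) * M n m) = of_real (a n * (cmod (f n))\<^sup>2)" if "n \<in> A" for n
  proof -
    have "(\<Sum>m\<in>A. f n * cnj (f m) * M n m) = (\<Sum>m\<in>A. if n = m then f n * cnj (f n) * of_real (a n) else 0)"
      using assms(2) that by (intro sum.cong refl) auto
    also have "\<dots> = f n * cnj (f n) * of_real (a n)" using assms(1) that by simp
    finally show ?thesis by (simp add: complex_norm_square mult_ac del: of_real_power)
  qed
  then show ?thesis by simp
qed

lemma K_AD_odd:
  assumes "odd N"
  shows "K_AD N u v l = of_real (real N / (4 * pi) * (\<Sum>n=1..N-1.
     sin (pi * real n / real N) / cos (pi * real n / real N) *
       (cmod (char_coeff N (R_period N u v l) n))\<^sup>2))"
proof -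
  define r where "r = AD_rank N"
  have N: "N = 2 * r + 1" using assms by (auto simp: r_def AD_rank_def elim!: oddE)
  define x where "x = (\<lambda>n::nat. pi * real n / real N)"
  define f where "f = char_coeff N (R_period N u v l)"
  have x0: "x 0 = 0" by (simp add: x_def)
  have p: "cis (2 * real (2 * r + 1) * x n) = 1" for n
    using cis_angle_period[of N n] N by (simp add: x_def)
  have s: "sin (x n - x m) \<noteq> 0" if "n < N" "m < N" "n \<noteq> m" for n m
    using sin_diff_angles[OF that] by (simp add: x_def)
  have s0: "sin (x n) \<noteq> 0" if "n < N" "n \<noteq> 0" for n
    using s[of n 0] that N x0 by simp
  have k: "kahler_kernel r (x n) (x m) =
      (if n = m then of_real (real N * (sin (x n) / cos (x n))) else 0)" if "n < N" "m < N" for n m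
  proof (cases "n = 0 \<or> m = 0")
    case True
    then show ?thesis by (auto simp: x0)
  next
    case False
    then show ?thesis
      using kahler_kernel_odd_diag[OF p[of n]] kahler_kernel_odd_off_diag[OF p p, of n m] s s0 that N
      by auto
  qed
  have "K_AD N u v l = of_real (1 / (4 * pi)) *
      (\<Sum>n<N. \<Sum>m<N. f n * cnj (f m) * kahler_kernel r (x n) (x m))"
    unfolding f_def x_def r_def using N by (intro K_AD_eq) simp
  also have "\<dots> = of_real (1 / (4 * pi)) *
      of_real (\<Sum>n<N. real N * (sin (x n) / cos (x n)) * (cmod (f n))\<^sup>2)"
    using k by (subst sum_hermitian_diag) auto
  \<comment> \<open>The index 0 contributes nothing because its sine is 0.\<close>
  also have "{..<N} = insert 0 {1..N-1}" using N by auto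
  finally show ?thesis
    by (simp add: f_def x_def sum_distrib_left mult_ac)
qed

lemma K_AD_even:
  fixes u :: "nat \<Rightarrow> complex" and v l :: complex
  assumes "N = 2 * \<nu>" "0 < \<nu>"
  defines "f \<equiv> char_coeff N (R_period N u v l)"
    and "c \<equiv> \<lambda>n::nat. cos (pi * real n / real N)"
  shows "K_AD N u v l = of_real (real N / (4 * pi) * (\<Sum>n\<in>{1..N-1} - {\<nu>}.
       sin (pi * real n / real N) / c n * (cmod (f n))\<^sup>2))
     + of_real (real N / (8 * pi)) *
       (f \<nu> * (\<Sum>n\<in>{1..N-1} - {\<nu>}. (eps N ^ (2 * n) - 1) / of_real (c n) * cnj (f n))
       + cnj (f \<nu> * (\<Sum>n\<in>{1..N-1} - {\<nu>}. (eps N ^ (2 * n) - 1) / of_real (c n) * cnj (f n))))"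
proof -
  define r where "r = AD_rank N"
  have r: "\<nu> = Suc r" using assms(1,2) by (simp add: r_def AD_rank_def)
  define x where "x = (\<lambda>n::nat. pi * real n / real N)"
  define I where "I = {1..N-1} - {\<nu>}"
  define M where "M = (\<lambda>n m. kahler_kernel r (x n) (x m))"
  have x0: "x 0 = 0" by (simp add: x_def)
  have xnu: "x \<nu> = pi / 2" using assms(1,2) by (simp add: x_def field_simps)
  have p: "cis (4 * real (Suc r) * x n) = 1" for n
    using cis_angle_period[of N n] assms(1,2) r by (simp add: x_def)
  have s: "sin (x n - x m) \<noteq> 0" if "n < N" "m < N" "n \<noteq> m" for n m
    using sin_diff_angles[OF that] by (simp add: x_def)
  have s0: "sin (x n) \<noteq> 0" if "n \<in> I" for n
  proof -
    have "n < N" "n \<noteq> 0" using that assms(1,2) by (auto simp: I_def)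
    then show ?thesis using s[of n 0] x0 by simp
  qed
  have c0: "cos (x n) \<noteq> 0" if "n \<in> I" for n
  proof -
    have "n < N" "\<nu> < N" "n \<noteq> \<nu>" using that assms(1,2) by (auto simp: I_def)
    \<comment> \<open>The sine of \<open>x n - pi / 2\<close> is \<open>- cos (x n)\<close>.\<close>
    then show ?thesis using s[of n \<nu>] xnu by (simp add: sin_diff)
  qed
  have M0: "M 0 m = 0" "M n 0 = 0" for n m by (simp_all add: M_def x0)
  have Mnu: "M \<nu> \<nu> = 0" by (simp add: M_def xnu kahler_kernel_pi_half_diag)
  have MI: "M n m = (if n = m then of_real (real N * (sin (x n) / cos (x n))) else 0)"
    if "n \<in> I" "m \<in> I" for n m
    using kahler_kernel_even_diag[OF p[of n]] kahler_kernel_even_off_diag[OF p p, of n m]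
      s[of n m] s0 c0 that assms(1) r by (auto simp: M_def I_def)
  have MnuI: "M \<nu> m = of_real (real N / 2) * ((eps N ^ (2 * m) - 1) / of_real (c m))" if "m \<in> I" for m
  proof -
    have "complex_of_real (real N / 2) = of_nat (Suc r)" using assms(1) r by simp
    moreover have "eps N ^ (2 * m) = cis (2 * x m)" by (simp add: eps_power x_def mult_ac)
    moreover have "c m = cos (x m)" by (simp add: c_def x_def)
    ultimately show ?thesis
      using kahler_kernel_pi_half[OF p s0 c0, OF that that] by (simp only: M_def xnu times_divide_eq_right)
  qed
  have MInu: "M m \<nu> = cnj (M \<nu> m)" for m
    unfolding M_def by (rule kahler_kernel_swap)
  define T where "T = f \<nu> * (\<Sum>n\<in>I. (eps N ^ (2 * n) - 1) / of_real (c n) * cnj (f n))"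
  have T: "(\<Sum>m\<in>I. f \<nu> * cnj (f m) * M \<nu> m) = of_real (real N / 2) * T"
    unfolding T_def sum_distrib_left by (intro sum.cong refl) (simp add: MnuI mult_ac)
  have "(\<Sum>n\<in>I. f n * cnj (f \<nu>) * M n \<nu>) = cnj (\<Sum>m\<in>I. f \<nu> * cnj (f m) * M \<nu> m)"
    by (simp add: MInu mult_ac)
  then have T': "(\<Sum>n\<in>I. f n * cnj (f \<nu>) * M n \<nu>) = of_real (real N / 2) * cnj T"
    unfolding T by simp
  have L: "{..<N} = insert 0 (insert \<nu> I)" "0 \<notin> insert \<nu> I" "\<nu> \<notin> I" "finite I"
    using assms(1,2) by (auto simp: I_def)
  have D: "(\<Sum>n\<in>I. \<Sum>m\<in>I. f n * cnj (f m) * M n m) =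
      of_real (\<Sum>n\<in>I. real N * (sin (x n) / cos (x n)) * (cmod (f n))\<^sup>2)"
    using L(4) MI by (rule sum_hermitian_diag)
  have "K_AD N u v l = of_real (1 / (4 * pi)) * (\<Sum>n<N. \<Sum>m<N. f n * cnj (f m) * M n m)"
    unfolding f_def M_def x_def r_def using assms(1,2) by (intro K_AD_eq) simp
  \<comment> \<open>Row and column 0 and the entry at \<open>(\<nu>, \<nu>)\<close> vanish. What
    remains is the block over \<open>I\<close>, which is diagonal, and the row and column of
    \<open>\<nu>\<close>, whose sums are conjugate by Hermitian symmetry.\<close>
  also have "(\<Sum>n<N. \<Sum>m<N. f n * cnj (f m) * M n m) =
      (\<Sum>n\<in>I. \<Sum>m\<in>I. f n * cnj (f m) * M n m)
      + ((\<Sum>m\<in>I. f \<nu> * cnj (f m) * M \<nu> m) + (\<Sum>n\<in>I. f n * cnj (f \<nu>) * M n \<nu>))"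
    unfolding L(1) using L(2-4) by (simp add: M0 Mnu sum.distrib)
  also have "\<dots> = of_real (\<Sum>n\<in>I. real N * (sin (x n) / cos (x n)) * (cmod (f n))\<^sup>2)
      + of_real (real N / 2) * (T + cnj T)"
    unfolding D T T' distrib_left ..
  finally have "K_AD N u v l = of_real (1 / (4 * pi) * (\<Sum>n\<in>I. real N * (sin (x n) / cos (x n)) * (cmod (f n))\<^sup>2))
      + of_real (1 / (4 * pi) * (real N / 2)) * (T + cnj T)"
    by (simp only: distrib_left of_real_mult mult.assoc)
  moreover have "1 / (4 * pi) * (\<Sum>n\<in>I. real N * (sin (x n) / cos (x n)) * (cmod (f n))\<^sup>2) =
      real N / (4 * pi) * (\<Sum>n\<in>I. sin (x n) / c n * (cmod (f n))\<^sup>2)"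
    unfolding c_def x_def sum_distrib_left by (intro sum.cong refl) simp
  ultimately show ?thesis
    unfolding I_def[symmetric] T_def[symmetric] by (simp only: x_def) simp
qed

theorem theorem4p3:
  fixes N :: nat
  assumes "N \<ge> 3"
  defines "s \<equiv> \<lambda>n::nat. sin (pi * real n / real N)"
    and "c \<equiv> \<lambda>n::nat. cos (pi * real n / real N)"
  shows "\<exists>\<delta>>0. \<forall>(v::complex) l u.
    v \<noteq> 0 \<and> exp l = v \<and> (\<forall>n\<in>{1..N-2}. cmod (scaled_coeff N u l n) < \<delta>) \<longrightarrow>
    (let Rc = char_coeff N (R_period N u v l) in
      (odd N \<longrightarrow>
        K_AD N u v l =
          of_real (real N / (4 * pi) * (\<Sum>n=1..N-1. s n / c n * (cmod (Rc n))\<^sup>2))) \<and>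
      (\<forall>\<nu>. N = 2 * \<nu> \<longrightarrow>
        K_AD N u v l =
          of_real (real N / (4 * pi) * (\<Sum>n\<in>{1..N-1} - {\<nu>}. s n / c n * (cmod (Rc n))\<^sup>2))
          + of_real (real N / (8 * pi)) *
            (Rc \<nu> * (\<Sum>n\<in>{1..N-1} - {\<nu>}. (eps N ^ (2 * n) - 1) / of_real (c n) * cnj (Rc n))
             + cnj (Rc \<nu> * (\<Sum>n\<in>{1..N-1} - {\<nu>}. (eps N ^ (2 * n) - 1) / of_real (c n) * cnj (Rc n))))))"
proof (intro exI[of _ 1] conjI allI impI)
  fix v l :: complex and u :: "nat \<Rightarrow> complex"
  show "let Rc = char_coeff N (R_period N u v l) in
      (odd N \<longrightarrow>
        K_AD N u v l =
          of_real (real N / (4 * pi) * (\<Sum>n=1..N-1. s n / c n * (cmod (Rc n))\<^sup>2))) \<and>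
      (\<forall>\<nu>. N = 2 * \<nu> \<longrightarrow>
        K_AD N u v l =
          of_real (real N / (4 * pi) * (\<Sum>n\<in>{1..N-1} - {\<nu>}. s n / c n * (cmod (Rc n))\<^sup>2))
          + of_real (real N / (8 * pi)) *
            (Rc \<nu> * (\<Sum>n\<in>{1..N-1} - {\<nu>}. (eps N ^ (2 * n) - 1) / of_real (c n) * cnj (Rc n))
             + cnj (Rc \<nu> * (\<Sum>n\<in>{1..N-1} - {\<nu>}. (eps N ^ (2 * n) - 1) / of_real (c n) * cnj (Rc n)))))"
    unfolding Let_def s_def c_def
    by (intro conjI allI impI; rule K_AD_odd K_AD_even; (assumption | use assms(1) in linarith))
qed simp

end
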